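(* Let $k$ be a field of characteristic different from two and let $H=\langle x,y\mid [x,[y,x]]=[y,[y,x]]=0\rangle$ be the Heisenberg Lie $k$-algebra, with $z=[y,x]$. Any $k$-involution $\tau\colon H\to H$ is equivalent to one of the following involutions $\eta\colon H\to H$: (1) $\eta(x)=x,\ \eta(y)=-y,\ \eta(z)=z$. More precisely, any $k$-involution $\tau$ of the form $\tau(x)=ax+by+cz$, $\tau(y)=dx-ay+fz$, $\tau(z)=z$, where $a,b,c,d,f\in k$ satisfy $a^2+bd=1$, $(a+1)c+bf=0$ and $dc+(1-a)f=0$, is equivalent to this $\eta$. (2) $\eta(x)=x,\ \eta(y)=y,\ \eta(z)=-z$. More precisely, any $k$-involution $\tau$ of the form $\tau(x)=x+cz$, $\tau(y)=y+fz$, $\tau(z)=-z$, where $c,f\in k$, is equivalent to this $\eta$. (3) The principal involution $\eta(x)=-x,\ \eta(y)=-y,\ \eta(z)=-z$.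
   Context: A $k$-involution of a Lie $k$-algebra $L$ is a $k$-linear map $*\colon L\to L$ such that $[a,b]^*=[b^*,a^*]$ and $a^{**}=a$ for all $a,b\in L$. Two $k$-involutions $\tau,\eta$ of $L$ are equivalent if there is a Lie $k$-algebra isomorphism $\varphi\colon L\to L$ with $\varphi^{-1}\tau\varphi=\eta$. $H$ has $k$-basis $x,y,z$ with $z$ central. *)

theory Defs
  imports Complex_Main
begin

locale lie_algebra = vector_space scale
  for scale :: "'k::field \<Rightarrow> 'l::ab_group_add \<Rightarrow> 'l" (infixr \<open>*s\<close> 75) +
  fixes bracket :: "'l \<Rightarrow> 'l \<Rightarrow> 'l"
  assumes bracket_add_left: "bracket (a + b) c = bracket a c + bracket b c"
    and bracket_add_right: "bracket a (b + c) = bracket a b + bracket a c"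
    and bracket_scale_left: "bracket (r *s a) b = r *s bracket a b"
    and bracket_scale_right: "bracket a (r *s b) = r *s bracket a b"
    and bracket_self: "bracket a a = 0"
    and jacobi: "bracket a (bracket b c) + bracket b (bracket c a) + bracket c (bracket a b) = 0"
begin

definition involution :: "('l \<Rightarrow> 'l) \<Rightarrow> bool" where
  "involution \<tau> \<longleftrightarrow> Vector_Spaces.linear scale scale \<tau> \<and>
     (\<forall>a b. \<tau> (bracket a b) = bracket (\<tau> b) (\<tau> a)) \<and> (\<forall>a. \<tau> (\<tau> a) = a)"

definition automorphism :: "('l \<Rightarrow> 'l) \<Rightarrow> bool" where
  "automorphism \<phi> \<longleftrightarrow> Vector_Spaces.linear scale scale \<phi> \<and>
     (\<forall>a b. \<phi> (bracket a b) = bracket (\<phi> a) (\<phi> b)) \<and> bij \<phi>"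

definition equivalent :: "('l \<Rightarrow> 'l) \<Rightarrow> ('l \<Rightarrow> 'l) \<Rightarrow> bool" where
  "equivalent \<tau> \<eta> \<longleftrightarrow> (\<exists>\<phi>. automorphism \<phi> \<and> inv \<phi> \<circ> \<tau> \<circ> \<phi> = \<eta>)"

end

datatype ('k, 'g) lie_term =
    Gen 'g
  | Zero
  | Add "('k, 'g) lie_term" "('k, 'g) lie_term"
  | Scale 'k "('k, 'g) lie_term"
  | Bracket "('k, 'g) lie_term" "('k, 'g) lie_term"

text \<open>The least congruence on terms that forces the axioms of a Lie algebra and
  sends the relators in \<open>R\<close> to zero. The quotient of the terms by it is the
  Lie algebra presented by the generators \<open>'g\<close> and the relators \<open>R\<close>.\<close>

inductive lie_cong :: "('k::field, 'g) lie_term set \<Rightarrow> ('k, 'g) lie_term \<Rightarrow> ('k, 'g) lie_term \<Rightarrow> bool"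
  for R where
  refl: "lie_cong R s s"
| sym: "lie_cong R s t \<Longrightarrow> lie_cong R t s"
| trans: "lie_cong R s t \<Longrightarrow> lie_cong R t u \<Longrightarrow> lie_cong R s u"
| Add: "lie_cong R s s' \<Longrightarrow> lie_cong R t t' \<Longrightarrow> lie_cong R (Add s t) (Add s' t')"
| Scale: "lie_cong R s s' \<Longrightarrow> lie_cong R (Scale a s) (Scale a s')"
| Bracket: "lie_cong R s s' \<Longrightarrow> lie_cong R t t' \<Longrightarrow> lie_cong R (Bracket s t) (Bracket s' t')"
| add_assoc: "lie_cong R (Add (Add s t) u) (Add s (Add t u))"
| add_commute: "lie_cong R (Add s t) (Add t s)"
| add_zero: "lie_cong R (Add Zero s) s"
| add_neg: "lie_cong R (Add (Scale (- 1) s) s) Zero"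
| scale_add_right: "lie_cong R (Scale a (Add s t)) (Add (Scale a s) (Scale a t))"
| scale_add_left: "lie_cong R (Scale (a + b) s) (Add (Scale a s) (Scale b s))"
| scale_scale: "lie_cong R (Scale a (Scale b s)) (Scale (a * b) s)"
| scale_one: "lie_cong R (Scale 1 s) s"
| bracket_add_left: "lie_cong R (Bracket (Add s t) u) (Add (Bracket s u) (Bracket t u))"
| bracket_add_right: "lie_cong R (Bracket s (Add t u)) (Add (Bracket s t) (Bracket s u))"
| bracket_scale_left: "lie_cong R (Bracket (Scale a s) t) (Scale a (Bracket s t))"
| bracket_scale_right: "lie_cong R (Bracket s (Scale a t)) (Scale a (Bracket s t))"
| bracket_self: "lie_cong R (Bracket s s) Zero"
| jacobi: "lie_cong R (Add (Add (Bracket s (Bracket t u)) (Bracket t (Bracket u s)))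
                         (Bracket u (Bracket s t))) Zero"
| relator: "r \<in> R \<Longrightarrow> lie_cong R r Zero"

lemma equivp_lie_cong: "equivp (lie_cong R)"
  by (intro equivpI reflpI sympI transpI) (blast intro: lie_cong.refl lie_cong.sym lie_cong.trans)+

datatype heis_gen = X | Y

definition heis_relators :: "('k::field, heis_gen) lie_term set" where
  "heis_relators = {Bracket (Gen X) (Bracket (Gen Y) (Gen X)),
                    Bracket (Gen Y) (Bracket (Gen Y) (Gen X))}"

quotient_type (overloaded) 'k heisenberg = "('k::field, heis_gen) lie_term" / "lie_cong heis_relators"
  by (rule equivp_lie_cong)

instantiation heisenberg :: (field) ab_group_add
begin

lift_definition zero_heisenberg :: "'a heisenberg" is Zero .

lift_definition plus_heisenberg :: "'a heisenberg \<Rightarrow> 'a heisenberg \<Rightarrow> 'a heisenberg" is Add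
  by (rule lie_cong.Add)

lift_definition uminus_heisenberg :: "'a heisenberg \<Rightarrow> 'a heisenberg" is "Scale (- 1)"
  by (rule lie_cong.Scale)

definition minus_heisenberg :: "'a heisenberg \<Rightarrow> 'a heisenberg \<Rightarrow> 'a heisenberg" where
  "minus_heisenberg u v = u + - v"

instance
proof
  fix a b c :: "'a heisenberg"
  show "a + b + c = a + (b + c)" by transfer (rule lie_cong.add_assoc)
  show "a + b = b + a" by transfer (rule lie_cong.add_commute)
  show "0 + a = a" by transfer (rule lie_cong.add_zero)
  show "- a + a = 0" by transfer (rule lie_cong.add_neg)
  show "a - b = a + - b" by (rule minus_heisenberg_def)
qed

end

lift_definition heis_scale :: "'k::field \<Rightarrow> 'k heisenberg \<Rightarrow> 'k heisenberg" (infixr \<open>*\<^sub>H\<close> 75) is Scale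
  by (rule lie_cong.Scale)

lift_definition heis_bracket :: "'k::field heisenberg \<Rightarrow> 'k heisenberg \<Rightarrow> 'k heisenberg" is Bracket
  by (rule lie_cong.Bracket)

lift_definition heis_x :: "'k::field heisenberg" is "Gen X" .

lift_definition heis_y :: "'k::field heisenberg" is "Gen Y" .

definition heis_z :: "'k::field heisenberg" where
  "heis_z = heis_bracket heis_y heis_x"

interpretation heis: lie_algebra heis_scale heis_bracket
proof
  fix r s :: "'k::field" and a b c :: "'k heisenberg"
  show "r *\<^sub>H (a + b) = r *\<^sub>H a + r *\<^sub>H b" by transfer (rule lie_cong.scale_add_right)
  show "(r + s) *\<^sub>H a = r *\<^sub>H a + s *\<^sub>H a" by transfer (rule lie_cong.scale_add_left)
  show "r *\<^sub>H s *\<^sub>H a = (r * s) *\<^sub>H a" by transfer (rule lie_cong.scale_scale)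
  show "1 *\<^sub>H a = a" by transfer (rule lie_cong.scale_one)
  show "heis_bracket (a + b) c = heis_bracket a c + heis_bracket b c"
    by transfer (rule lie_cong.bracket_add_left)
  show "heis_bracket a (b + c) = heis_bracket a b + heis_bracket a c"
    by transfer (rule lie_cong.bracket_add_right)
  show "heis_bracket (r *\<^sub>H a) b = r *\<^sub>H heis_bracket a b"
    by transfer (rule lie_cong.bracket_scale_left)
  show "heis_bracket a (r *\<^sub>H b) = r *\<^sub>H heis_bracket a b"
    by transfer (rule lie_cong.bracket_scale_right)
  show "heis_bracket a a = 0" by transfer (rule lie_cong.bracket_self)
  show "heis_bracket a (heis_bracket b c) + heis_bracket b (heis_bracket c a)
      + heis_bracket c (heis_bracket a b) = 0"
    by transfer (rule lie_cong.jacobi)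
qed

lemma heis_bracket_xz: "heis_bracket heis_x heis_z = (0 :: 'k::field heisenberg)"
  unfolding heis_z_def by transfer (rule lie_cong.relator, simp add: heis_relators_def)

lemma heis_bracket_yz: "heis_bracket heis_y heis_z = (0 :: 'k::field heisenberg)"
  unfolding heis_z_def by transfer (rule lie_cong.relator, simp add: heis_relators_def)

lemma heis_bracket_swap: "heis_bracket a b = - heis_bracket b a"
proof -
  have "heis_bracket (a + b) (a + b) = 0" by (rule heis.bracket_self)
  then have "heis_bracket a b + heis_bracket b a = 0"
    unfolding heis.bracket_add_left heis.bracket_add_right by (simp add: heis.bracket_self add.commute)
  then show ?thesis by (simp add: eq_neg_iff_add_eq_0)
qed

text \<open>Coordinates with respect to \<open>x, y, z\<close>, read off from a representing term; they show
  that the quotient does not collapse.\<close>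

fun term_coords :: "('k::field, heis_gen) lie_term \<Rightarrow> 'k \<times> 'k \<times> 'k" where
  "term_coords (Gen X) = (1, 0, 0)"
| "term_coords (Gen Y) = (0, 1, 0)"
| "term_coords Zero = (0, 0, 0)"
| "term_coords (Add s t) = (case (term_coords s, term_coords t) of
     ((a, b, c), (a', b', c')) \<Rightarrow> (a + a', b + b', c + c'))"
| "term_coords (Scale r t) = (case term_coords t of (a, b, c) \<Rightarrow> (r * a, r * b, r * c))"
| "term_coords (Bracket s t) = (case (term_coords s, term_coords t) of
     ((a, b, c), (a', b', c')) \<Rightarrow> (0, 0, b * a' - a * b'))"

lift_definition heis_coords :: "'k::field heisenberg \<Rightarrow> 'k \<times> 'k \<times> 'k" is term_coords
proof -
  fix s t :: "('k, heis_gen) lie_term"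
  assume "lie_cong heis_relators s t"
  then show "term_coords s = term_coords t"
    by (induction rule: lie_cong.induct)
      (auto simp: heis_relators_def algebra_simps split: prod.splits)
qed

lemma heis_coords_xyz:
  "heis_coords (a *\<^sub>H heis_x + b *\<^sub>H heis_y + c *\<^sub>H heis_z) = (a, b, c)"
  unfolding heis_z_def by transfer simp

lemma heis_z_central: "heis_bracket heis_z u = (0 :: 'k::field heisenberg)"
proof -
  have gens: "heis_bracket heis_z heis_x = (0 :: 'k heisenberg)" "heis_bracket heis_z heis_y = (0 :: 'k heisenberg)"
    using heis_bracket_swap[of heis_z heis_x] heis_bracket_swap[of heis_z heis_y]
    by (simp_all add: heis_bracket_xz heis_bracket_yz)
  have zero: "heis_bracket v 0 = 0" for v :: "'k heisenberg"
    using heis.bracket_scale_right[of v 0 0] by simp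
  have "heis_bracket heis_z (abs_heisenberg t) = 0" for t :: "('k, heis_gen) lie_term"
  proof (induction t)
    case (Gen g)
    then show ?case using gens
      by (cases g) (simp_all add: heis_x.abs_eq heis_y.abs_eq)
  next
    case Zero
    then show ?case using zero by (simp add: zero_heisenberg.abs_eq)
  next
    case (Add s t)
    then show ?case
      using heis.bracket_add_right[of heis_z "abs_heisenberg s" "abs_heisenberg t"]
      by (simp add: plus_heisenberg.abs_eq)
  next
    case (Scale a t)
    then show ?case
      using heis.bracket_scale_right[of heis_z a "abs_heisenberg t"]
      by (simp add: heis_scale.abs_eq)
  next
    case (Bracket s t)
    let ?s = "abs_heisenberg s" and ?t = "abs_heisenberg t"
    have "heis_bracket ?t heis_z = 0" 
      using Bracket heis_bracket_swap[of ?t heis_z] by simp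
    then have "heis_bracket heis_z (heis_bracket ?s ?t) = 0"
      using heis.jacobi[of heis_z ?s ?t] Bracket zero by simp
    then show ?case by (simp add: heis_bracket.abs_eq)
  qed
  then show ?thesis by (metis Quotient3_abs_rep Quotient3_heisenberg)
qed

lemma heis_coords_inverse:
  assumes "heis_coords u = (a, b, c)"
  shows "u = a *\<^sub>H heis_x + b *\<^sub>H heis_y + c *\<^sub>H heis_z"
proof -
  have right: "heis_bracket u heis_z = 0" for u :: "'a heisenberg"
    using heis_bracket_swap[of u heis_z] by (simp add: heis_z_central)
  have xy: "heis_bracket heis_x heis_y = - (heis_z :: 'a heisenberg)"
    unfolding heis_z_def by (rule heis_bracket_swap)
  have "\<exists>a b c. abs_heisenberg t = a *\<^sub>H heis_x + b *\<^sub>H heis_y + c *\<^sub>H heis_z"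
    for t :: "('a, heis_gen) lie_term"
  proof (induction t)
    case (Gen g)
    have "heis_x = 1 *\<^sub>H heis_x + 0 *\<^sub>H heis_y + 0 *\<^sub>H (heis_z :: 'a heisenberg)"
      "heis_y = 0 *\<^sub>H heis_x + 1 *\<^sub>H heis_y + 0 *\<^sub>H (heis_z :: 'a heisenberg)" by simp_all
    then show ?case
      unfolding heis_x.abs_eq[symmetric] heis_y.abs_eq[symmetric]
      by (cases g) (metis heis_x.abs_eq heis_y.abs_eq)+
  next
    case Zero
    have "0 = 0 *\<^sub>H heis_x + 0 *\<^sub>H heis_y + 0 *\<^sub>H (heis_z :: 'a heisenberg)" by simp
    then show ?case by (metis zero_heisenberg.abs_eq)
  next
    case (Add s t)
    then obtain a b c a' b' c' where
      "abs_heisenberg s = a *\<^sub>H heis_x + b *\<^sub>H heis_y + c *\<^sub>H heis_z"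
      "abs_heisenberg t = a' *\<^sub>H heis_x + b' *\<^sub>H heis_y + c' *\<^sub>H heis_z" by blast
    then have "abs_heisenberg (Add s t)
        = (a + a') *\<^sub>H heis_x + (b + b') *\<^sub>H heis_y + (c + c') *\<^sub>H heis_z"
      by (simp add: plus_heisenberg.abs_eq[symmetric] heis.scale_left_distrib algebra_simps)
    then show ?case by blast
  next
    case (Scale r t)
    then obtain a b c where
      "abs_heisenberg t = a *\<^sub>H heis_x + b *\<^sub>H heis_y + c *\<^sub>H heis_z" by blast
    then have "abs_heisenberg (Scale r t)
        = (r * a) *\<^sub>H heis_x + (r * b) *\<^sub>H heis_y + (r * c) *\<^sub>H heis_z"
      by (simp add: heis_scale.abs_eq[symmetric] heis.scale_right_distrib)
    then show ?case by blast
  next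
    case (Bracket s t)
    then obtain a b c a' b' c' where
      "abs_heisenberg s = a *\<^sub>H heis_x + b *\<^sub>H heis_y + c *\<^sub>H heis_z"
      "abs_heisenberg t = a' *\<^sub>H heis_x + b' *\<^sub>H heis_y + c' *\<^sub>H heis_z" by blast
    then have "abs_heisenberg (Bracket s t)
        = 0 *\<^sub>H heis_x + 0 *\<^sub>H heis_y + (b * a' - a * b') *\<^sub>H heis_z"
      by (simp add: heis_bracket.abs_eq[symmetric] heis.bracket_add_left heis.bracket_add_right
          heis.bracket_scale_left heis.bracket_scale_right heis.bracket_self heis_z_central
          right xy heis_z_def[symmetric] heis.scale_left_diff_distrib mult.commute)
    then show ?case by blast
  qed
  then obtain a' b' c' where u: "u = a' *\<^sub>H heis_x + b' *\<^sub>H heis_y + c' *\<^sub>H heis_z"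
    by (metis Quotient3_abs_rep Quotient3_heisenberg)
  with assms have "(a', b', c') = (a, b, c)" by (simp add: heis_coords_xyz)
  with u show ?thesis by simp
qed

lemma heis_basis:
  "heis_x \<noteq> (heis_y :: 'k::field heisenberg)"
  "heis_x \<noteq> (heis_z :: 'k heisenberg)"
  "heis_y \<noteq> (heis_z :: 'k heisenberg)"
  "heis.independent {heis_x, heis_y, heis_z :: 'k heisenberg}"
  "heis.span {heis_x, heis_y, heis_z :: 'k heisenberg} = UNIV"
proof -
  have coords: "heis_coords heis_x = (1, 0, 0 :: 'k)" "heis_coords heis_y = (0, 1, 0 :: 'k)"
    "heis_coords heis_z = (0, 0, 1 :: 'k)" "heis_coords (0 :: 'k heisenberg) = (0, 0, 0)"
    using heis_coords_xyz[of "1::'k" 0 0] heis_coords_xyz[of 0 "1::'k" 0]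
      heis_coords_xyz[of 0 0 "1::'k"] heis_coords_xyz[of "0::'k" 0 0] by simp_all
  show ne: "heis_x \<noteq> (heis_y :: 'k heisenberg)" "heis_x \<noteq> (heis_z :: 'k heisenberg)"
    "heis_y \<noteq> (heis_z :: 'k heisenberg)"
    using coords by (metis prod.inject zero_neq_one)+
  show "heis.independent {heis_x, heis_y, heis_z :: 'k heisenberg}"
  proof (rule heis.independent_if_scalars_zero)
    fix g :: "'k heisenberg \<Rightarrow> 'k" and v :: "'k heisenberg"
    assume "(\<Sum>v\<in>{heis_x, heis_y, heis_z}. g v *\<^sub>H v) = 0" and v: "v \<in> {heis_x, heis_y, heis_z}"
    then have "g heis_x *\<^sub>H heis_x + g heis_y *\<^sub>H heis_y + g heis_z *\<^sub>H heis_z = 0"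
      using ne by (simp add: add.assoc)
    then have "(g heis_x, g heis_y, g heis_z) = (0, 0, 0)"
      using heis_coords_xyz coords(4) by metis
    then show "g v = 0" using v by auto
  qed simp
  have "u \<in> heis.span {heis_x, heis_y, heis_z}" for u :: "'k heisenberg"
  proof -
    obtain a b c where "heis_coords u = (a, b, c)" by (cases "heis_coords u")
    then have "u = a *\<^sub>H heis_x + b *\<^sub>H heis_y + c *\<^sub>H heis_z" by (rule heis_coords_inverse)
    then show ?thesis
      by (simp add: heis.span_add heis.span_scale heis.span_base)
  qed
  then show "heis.span {heis_x, heis_y, heis_z :: 'k heisenberg} = UNIV" by auto
qed

end

theory Submission
  imports Defs
begin

text \<open>
  For an involution \<open>\<tau>\<close>, write \<open>u\<^sub>+ = u + \<tau> u\<close> and \<open>u\<^sub>- = u - \<tau> u\<close>. Since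
  \<open>4 z = [2 y, 2 x] = [y\<^sub>+, x\<^sub>+] + [y\<^sub>+, x\<^sub>-] + [y\<^sub>-, x\<^sub>+] + [y\<^sub>-, x\<^sub>-]\<close> is nonzero, one of the
  four brackets is nonzero. Its entries are eigenvectors of \<open>\<tau>\<close> that can replace the generators
  \<open>x, y\<close>, and their two signs determine which of the three normal forms \<open>\<tau>\<close> has.
\<close>

section \<open>Involutions of an arbitrary Lie algebra and their symmetric and skew parts\<close>

lemma (in vector_space) scale_two: "scale 2 a = a + a"
  using scale_left_distrib[of 1 1 a] by simp

context lie_algebra
begin

lemma bracket_zero_left [simp]: "bracket 0 b = 0"
  using bracket_scale_left[of 0 0 b] by simp

lemma bracket_zero_right [simp]: "bracket a 0 = 0"
  using bracket_scale_right[of a 0 0] by simp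

lemma bracket_minus_left [simp]: "bracket (- a) b = - bracket a b"
  using bracket_scale_left[of "- 1" a b] by simp

lemma bracket_minus_right [simp]: "bracket a (- b) = - bracket a b"
  using bracket_scale_right[of a "- 1" b] by simp

lemma involution_linear: "involution \<tau> \<Longrightarrow> Vector_Spaces.linear scale scale \<tau>"
  by (simp add: involution_def)

lemma involution_bracket: "involution \<tau> \<Longrightarrow> \<tau> (bracket a b) = bracket (\<tau> b) (\<tau> a)"
  by (simp add: involution_def)

lemma involution_involution: "involution \<tau> \<Longrightarrow> \<tau> (\<tau> a) = a"
  by (simp add: involution_def)

lemma involution_add: "involution \<tau> \<Longrightarrow> \<tau> (a + b) = \<tau> a + \<tau> b"
  by (simp add: involution_def Vector_Spaces.linear_iff)

lemma involution_scale: "involution \<tau> \<Longrightarrow> \<tau> (r *s a) = r *s \<tau> a"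
  by (simp add: involution_def Vector_Spaces.linear_iff)

lemma involution_minus: "involution \<tau> \<Longrightarrow> \<tau> (- a) = - \<tau> a"
  using involution_scale[of \<tau> "- 1" a] by simp

text \<open>\<open>\<tau>\<close> exchanges \<open>a\<close> and \<open>\<tau> a\<close>, which
  makes their sum an eigenvector for 1 and their difference, in the next lemma, one for -1.\<close>

lemma involution_symmetric_part: "involution \<tau> \<Longrightarrow> \<tau> (a + \<tau> a) = a + \<tau> a"
  by (simp add: involution_add involution_involution add.commute)

lemma involution_skew_part: "involution \<tau> \<Longrightarrow> \<tau> (a - \<tau> a) = - (a - \<tau> a)"
  using involution_add[of \<tau> a "- \<tau> a"] by (simp add: involution_minus involution_involution)

text \<open>The sum and the difference of \<open>a\<close> and \<open>\<tau> a\<close> add up to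
  twice \<open>a\<close>, and likewise for \<open>b\<close>; expanding the bracket of the two
  doubles bilinearly gives the four terms.\<close>

lemma bracket_decomposition:
  "4 *s bracket a b =
     bracket (a + \<tau> a) (b + \<tau> b) + bracket (a + \<tau> a) (b - \<tau> b) +
     bracket (a - \<tau> a) (b + \<tau> b) + bracket (a - \<tau> a) (b - \<tau> b)"
proof -
  have "4 *s v = v + v + v + v" for v
    using scale_left_distrib[of 2 2 v] by (simp add: scale_two add.assoc)
  then show ?thesis
    by (simp only: diff_conv_add_uminus bracket_add_left bracket_add_right
        bracket_minus_left bracket_minus_right) (simp add: algebra_simps)
qed

end

section \<open>Coordinates and brackets in the Heisenberg algebra\<close>

interpretation heis: finite_dimensional_vector_space
  heis_scale "{heis_x, heis_y, heis_z :: 'k::field heisenberg}"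
  by unfold_locales (simp_all add: heis_basis)

lemma heis_z_nonzero: "heis_z \<noteq> (0 :: 'k::field heisenberg)"
  using heis.dependent_zero[of "{heis_x, heis_y, heis_z :: 'k heisenberg}"] heis_basis(4) by auto

lemma heis_z_central_right: "heis_bracket u heis_z = 0"
  using heis_bracket_swap[of u heis_z] by (simp add: heis_z_central)

lemma heis_cases:
  obtains a b c where "u = a *\<^sub>H heis_x + b *\<^sub>H heis_y + c *\<^sub>H heis_z"
  using heis_coords_inverse by (metis prod_cases3)

lemma heis_bracket_eq:
  fixes a b c a' b' c' :: "'k::field"
  shows "heis_bracket (a *\<^sub>H heis_x + b *\<^sub>H heis_y + c *\<^sub>H heis_z)
     (a' *\<^sub>H heis_x + b' *\<^sub>H heis_y + c' *\<^sub>H heis_z) = (b * a' - a * b') *\<^sub>H heis_z"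
proof -
  have "heis_bracket heis_x heis_y = - (heis_z :: 'k heisenberg)"
    unfolding heis_z_def by (rule heis_bracket_swap)
  then show ?thesis
    by (simp add: heis.bracket_add_left heis.bracket_add_right heis.bracket_scale_left
        heis.bracket_scale_right heis.bracket_self heis_z_central heis_z_central_right
        heis_z_def[symmetric] heis.scale_left_diff_distrib mult.commute)
qed

lemma heis_bracket_multiple: obtains r where "heis_bracket u v = r *\<^sub>H heis_z"
  by (metis heis_cases heis_bracket_eq)

text \<open>Every bracket is a multiple of the central \<open>heis_z\<close>: the algebra is
  nilpotent of class two. As a simp rule this lets computations with arbitrary \<open>p\<close>,
  \<open>q\<close> treat their bracket as central.\<close>

lemma heis_bracket_bracket [simp]:
  "heis_bracket (heis_bracket u v) w = 0" "heis_bracket w (heis_bracket u v) = 0"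
proof -
  obtain r where "heis_bracket u v = r *\<^sub>H heis_z" by (rule heis_bracket_multiple)
  then show "heis_bracket (heis_bracket u v) w = 0" "heis_bracket w (heis_bracket u v) = 0"
    by (simp_all add: heis.bracket_scale_left heis.bracket_scale_right
        heis_z_central heis_z_central_right)
qed

section \<open>Linear maps prescribed on the basis; automorphisms, involutions and
  equivalence\<close>

definition heis_extend ::
    "'k::field heisenberg \<Rightarrow> 'k heisenberg \<Rightarrow> 'k heisenberg \<Rightarrow> 'k heisenberg \<Rightarrow> 'k heisenberg" where
  "heis_extend p q r u = (case heis_coords u of (a, b, c) \<Rightarrow> a *\<^sub>H p + b *\<^sub>H q + c *\<^sub>H r)"

lemma heis_extend_eq:
  "heis_extend p q r (a *\<^sub>H heis_x + b *\<^sub>H heis_y + c *\<^sub>H heis_z) = a *\<^sub>H p + b *\<^sub>H q + c *\<^sub>H r"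
  by (simp add: heis_extend_def heis_coords_xyz)

lemma heis_extend_basis [simp]:
  "heis_extend p q r heis_x = p" "heis_extend p q r heis_y = q" "heis_extend p q r heis_z = r"
  using heis_extend_eq[of p q r 1 0 0] heis_extend_eq[of p q r 0 1 0] heis_extend_eq[of p q r 0 0 1]
  by simp_all

lemma linear_heis_extend: "Vector_Spaces.linear heis_scale heis_scale (heis_extend p q r)"
proof -
  have "heis_extend p q r (u + v) = heis_extend p q r u + heis_extend p q r v" for u v
  proof -
    obtain a b c where u: "u = a *\<^sub>H heis_x + b *\<^sub>H heis_y + c *\<^sub>H heis_z" by (rule heis_cases)
    obtain a' b' c' where v: "v = a' *\<^sub>H heis_x + b' *\<^sub>H heis_y + c' *\<^sub>H heis_z" by (rule heis_cases)
    have "u + v = (a + a') *\<^sub>H heis_x + (b + b') *\<^sub>H heis_y + (c + c') *\<^sub>H heis_z"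
      unfolding u v by (simp add: heis.scale_left_distrib algebra_simps)
    then have "heis_extend p q r (u + v) = (a + a') *\<^sub>H p + (b + b') *\<^sub>H q + (c + c') *\<^sub>H r"
      by (simp only: heis_extend_eq)
    then show ?thesis
      unfolding u v heis_extend_eq by (simp add: heis.scale_left_distrib algebra_simps)
  qed
  moreover have "heis_extend p q r (s *\<^sub>H u) = s *\<^sub>H heis_extend p q r u" for s u
  proof -
    obtain a b c where u: "u = a *\<^sub>H heis_x + b *\<^sub>H heis_y + c *\<^sub>H heis_z" by (rule heis_cases)
    have "s *\<^sub>H u = (s * a) *\<^sub>H heis_x + (s * b) *\<^sub>H heis_y + (s * c) *\<^sub>H heis_z"
      unfolding u by (simp add: heis.scale_right_distrib)
    then show ?thesis
      unfolding u heis_extend_eq by (simp add: heis_extend_eq heis.scale_right_distrib)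
  qed
  ultimately show ?thesis
    by (simp add: Vector_Spaces.linear_iff heis.vector_space_axioms)
qed

lemma heis_linear_eqI:
  fixes f g :: "'k::field heisenberg \<Rightarrow> 'k heisenberg"
  assumes f: "Vector_Spaces.linear heis_scale heis_scale f"
    and g: "Vector_Spaces.linear heis_scale heis_scale g"
    and "f heis_x = g heis_x" "f heis_y = g heis_y" "f heis_z = g heis_z"
  shows "f = g"
proof
  fix u :: "'k heisenberg"
  obtain a b c where "u = a *\<^sub>H heis_x + b *\<^sub>H heis_y + c *\<^sub>H heis_z" by (rule heis_cases)
  then show "f u = g u" using assms by (simp add: Vector_Spaces.linear_iff)
qed

text \<open>Only the image of \<open>heis_z\<close>, the bracket of \<open>heis_y\<close> with
  \<open>heis_x\<close>, decides how brackets behave: sending it to the bracket of \<open>q\<close>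
  with \<open>p\<close> gives a homomorphism, sending it to the opposite bracket gives an
  antihomomorphism. The first kind supplies automorphisms, the second involutions. All terms that
  involve the image of \<open>heis_z\<close> vanish because it is central.\<close>

lemma heis_extend_bracket:
  "heis_extend p q (heis_bracket q p) (heis_bracket u v) =
     heis_bracket (heis_extend p q (heis_bracket q p) u) (heis_extend p q (heis_bracket q p) v)"
  "heis_extend p q (heis_bracket p q) (heis_bracket u v) =
     heis_bracket (heis_extend p q (heis_bracket p q) v) (heis_extend p q (heis_bracket p q) u)"
proof -
  obtain a b c where u: "u = a *\<^sub>H heis_x + b *\<^sub>H heis_y + c *\<^sub>H heis_z" by (rule heis_cases)
  obtain a' b' c' where v: "v = a' *\<^sub>H heis_x + b' *\<^sub>H heis_y + c' *\<^sub>H heis_z" by (rule heis_cases)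
  have uv: "heis_bracket u v = 0 *\<^sub>H heis_x + 0 *\<^sub>H heis_y + (b * a' - a * b') *\<^sub>H heis_z"
    unfolding u v heis_bracket_eq by simp
  show "heis_extend p q (heis_bracket q p) (heis_bracket u v) =
     heis_bracket (heis_extend p q (heis_bracket q p) u) (heis_extend p q (heis_bracket q p) v)"
    \<comment> \<open>The bracket on the left is put into coordinates before \<open>u\<close> and
      \<open>v\<close> are expanded, since \<open>uv\<close> no longer matches afterwards.\<close>
    unfolding uv heis_extend_eq unfolding u v heis_extend_eq
    by (simp add: heis.bracket_add_left heis.bracket_add_right heis.bracket_scale_left
        heis.bracket_scale_right heis.bracket_self heis_bracket_swap[of p q]
        heis.scale_left_diff_distrib mult.commute)
  show "heis_extend p q (heis_bracket p q) (heis_bracket u v) =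
     heis_bracket (heis_extend p q (heis_bracket p q) v) (heis_extend p q (heis_bracket p q) u)"
    unfolding uv heis_extend_eq unfolding u v heis_extend_eq
    by (simp add: heis.bracket_add_left heis.bracket_add_right heis.bracket_scale_left
        heis.bracket_scale_right heis.bracket_self heis_bracket_swap[of q p]
        heis.scale_left_diff_distrib mult.commute)
qed

text \<open>Two elements that do not commute can replace the generators. The kernel is trivial by a
  computation with brackets, and finite dimension turns injectivity into bijectivity.\<close>

lemma automorphism_heis_extend:
  assumes "heis_bracket q p \<noteq> 0"
  shows "heis.automorphism (heis_extend p q (heis_bracket q p))"
proof -
  let ?f = "heis_extend p q (heis_bracket q p)"
  have zero: "u = 0" if "?f u = 0" for u
  proof -
    obtain a b c where u: "u = a *\<^sub>H heis_x + b *\<^sub>H heis_y + c *\<^sub>H heis_z" by (rule heis_cases)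
    have f: "?f u = a *\<^sub>H p + b *\<^sub>H q + c *\<^sub>H heis_bracket q p"
      unfolding u by (rule heis_extend_eq)
    \<comment> \<open>Bracketing with \<open>q\<close> removes the \<open>q\<close> term and the
      central term and so isolates \<open>a\<close>; bracketing with \<open>p\<close> isolates
      \<open>b\<close>. What remains of \<open>?f u = 0\<close> then forces
      \<open>c = 0\<close>.\<close>
    have "heis_bracket q (?f u) = a *\<^sub>H heis_bracket q p"
      "heis_bracket (?f u) p = b *\<^sub>H heis_bracket q p"
      unfolding f by (simp_all add: heis.bracket_add_left heis.bracket_add_right
          heis.bracket_scale_left heis.bracket_scale_right heis.bracket_self)
    with that assms have "a = 0" "b = 0" by simp_all
    with that f assms u show ?thesis by simp
  qed
  then have "inj ?f"
    by (metis module_hom.inj_iff_eq_0 linear_heis_extend module_hom_iff_linear)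
  then have "bij ?f"
    using heis.linear_inj_imp_surj linear_heis_extend by (blast intro: bijI)
  then show ?thesis
    by (simp add: heis.automorphism_def linear_heis_extend heis_extend_bracket)
qed

text \<open>The assumptions say that the square of the map fixes \<open>heis_x\<close> and
  \<open>heis_y\<close>. Being an antihomomorphism, the map sends the bracket of \<open>p\<close>
  with \<open>q\<close> to that of \<open>heis_y\<close> with \<open>heis_x\<close>, so its square
  fixes \<open>heis_z\<close> as well.\<close>

lemma involution_heis_extend:
  assumes "heis_extend p q (heis_bracket p q) p = heis_x"
    and "heis_extend p q (heis_bracket p q) q = heis_y"
  shows "heis.involution (heis_extend p q (heis_bracket p q))"
proof -
  let ?f = "heis_extend p q (heis_bracket p q)"
  have "?f (heis_bracket p q) = heis_z"
    using assms by (simp add: heis_extend_bracket heis_z_def)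
  then have "?f \<circ> ?f = id"
    using assms linear_heis_extend heis.linear_id
    by (intro heis_linear_eqI Vector_Spaces.linear_compose[of heis_scale heis_scale]) simp_all
  then show ?thesis
    by (auto simp: heis.involution_def linear_heis_extend heis_extend_bracket fun_eq_iff)
qed

text \<open>The conjugating automorphism \<open>?f\<close> sends \<open>heis_x\<close>,
  \<open>heis_y\<close> to \<open>p\<close>, \<open>q\<close>. The assumptions \<open>p\<close> and
  \<open>q\<close> state \<open>\<tau> \<circ> ?f = ?f \<circ> \<eta>\<close> on these generators;
  the same equation on \<open>heis_z\<close> follows because both composites reverse
  brackets.\<close>

lemma heis_equivalentI:
  assumes \<tau>: "heis.involution \<tau>" and \<eta>: "heis.involution \<eta>"
    and ne: "heis_bracket q p \<noteq> 0"
    and p: "\<tau> p = heis_extend p q (heis_bracket q p) (\<eta> heis_x)"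
    and q: "\<tau> q = heis_extend p q (heis_bracket q p) (\<eta> heis_y)"
  shows "heis.equivalent \<tau> \<eta>"
proof -
  let ?f = "heis_extend p q (heis_bracket q p)"
  have "\<tau> (heis_bracket q p) = ?f (\<eta> heis_z)"
    by (simp add: heis_z_def heis.involution_bracket[OF \<tau>] heis.involution_bracket[OF \<eta>]
        heis_extend_bracket p q)
  then have "\<tau> \<circ> ?f = ?f \<circ> \<eta>"
    using p q heis.involution_linear[OF \<tau>] heis.involution_linear[OF \<eta>] linear_heis_extend
    by (intro heis_linear_eqI Vector_Spaces.linear_compose[of heis_scale heis_scale]) simp_all
  moreover have aut: "heis.automorphism ?f" using ne by (rule automorphism_heis_extend)
  then have "inj ?f" by (simp add: heis.automorphism_def bij_is_inj)
  ultimately have "inv ?f \<circ> \<tau> \<circ> ?f = \<eta>"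
    by (metis comp_assoc id_comp inv_o_cancel)
  with aut show ?thesis unfolding heis.equivalent_def by blast
qed

section \<open>Signs of eigenvectors and the classification\<close>

lemma heis_extend_minus: "heis_extend p q r (- u) = - heis_extend p q r u"
  using linear_heis_extend[of p q r] unfolding Vector_Spaces.linear_iff
  by (metis heis.scale_minus_left heis.scale_one)

text \<open>With equal signs on \<open>p\<close> and \<open>q\<close> the signs cancel in the
  bracket, while the reversal of its arguments leaves a factor -1. So \<open>\<tau>\<close> negates
  a nonzero multiple of \<open>heis_z\<close>. This rules out equal signs for involutions that fix
  \<open>heis_z\<close>.\<close>

lemma heis_involution_z_skew:
  fixes \<tau> :: "'k::field heisenberg \<Rightarrow> 'k heisenberg"
  assumes two: "(2 :: 'k) \<noteq> 0" and \<tau>: "heis.involution \<tau>"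
    and ne: "heis_bracket q p \<noteq> 0"
    and pq: "\<tau> p = p \<and> \<tau> q = q \<or> \<tau> p = - p \<and> \<tau> q = - q"
  shows "\<tau> heis_z \<noteq> heis_z"
proof
  assume z: "\<tau> heis_z = heis_z"
  obtain r where r: "heis_bracket q p = r *\<^sub>H heis_z" by (rule heis_bracket_multiple)
  have "\<tau> (heis_bracket q p) = - heis_bracket q p"
    using pq heis_bracket_swap[of p q] by (auto simp: heis.involution_bracket[OF \<tau>])
  moreover have "\<tau> (heis_bracket q p) = heis_bracket q p"
    by (simp add: r heis.involution_scale[OF \<tau>] z)
  ultimately have "heis_bracket q p + heis_bracket q p = 0"
    by (metis add.right_inverse)
  then have "2 *\<^sub>H heis_bracket q p = 0"
    by (simp add: heis.scale_two)
  with two ne show False by simp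
qed

lemma heis_involution_eigenpair:
  fixes \<tau> :: "'k::field heisenberg \<Rightarrow> 'k heisenberg"
  assumes two: "(2 :: 'k) \<noteq> 0" and \<tau>: "heis.involution \<tau>"
  obtains (mixed) p q where "heis_bracket q p \<noteq> 0" "\<tau> p = p" "\<tau> q = - q"
    | (symmetric) p q where "heis_bracket q p \<noteq> 0" "\<tau> p = p" "\<tau> q = q"
    | (skew) p q where "heis_bracket q p \<noteq> 0" "\<tau> p = - p" "\<tau> q = - q"
proof -
  let ?xp = "heis_x + \<tau> heis_x" and ?xm = "heis_x - \<tau> heis_x"
  let ?yp = "heis_y + \<tau> heis_y" and ?ym = "heis_y - \<tau> heis_y"
  note eig = heis.involution_symmetric_part[OF \<tau>] heis.involution_skew_part[OF \<tau>]
  have "(4 :: 'k) = 2 * 2" by simp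
  then have "(4 :: 'k) \<noteq> 0" using two by (metis mult_eq_0_iff)
  then have "4 *\<^sub>H heis_bracket heis_y heis_x \<noteq> (0 :: 'k heisenberg)"
    using heis_z_nonzero by (simp flip: heis_z_def)
  then have "heis_bracket ?yp ?xp \<noteq> 0 \<or> heis_bracket ?yp ?xm \<noteq> 0 \<or>
      heis_bracket ?ym ?xp \<noteq> 0 \<or> heis_bracket ?ym ?xm \<noteq> 0"
    unfolding heis.bracket_decomposition[of heis_y heis_x \<tau>] by auto
  \<comment> \<open>The mixed case wants \<open>p\<close> fixed and \<open>q\<close> negated. If the
    nonzero bracket is that of \<open>?yp\<close> with \<open>?xm\<close>, the roles of the
    generators are swapped: \<open>p\<close> is \<open>?yp\<close> and \<open>q\<close> is
    \<open>?xm\<close>.\<close>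
  moreover have "heis_bracket ?xm ?yp \<noteq> 0" if "heis_bracket ?yp ?xm \<noteq> 0"
    using that heis_bracket_swap[of ?yp ?xm] by auto
  ultimately show thesis using eig mixed symmetric skew by blast
qed

text \<open>By linearity, the values on the basis determine each of the three normal forms, so the
  existential quantifiers can be satisfied in only one way.\<close>

theorem lemma3p2:
  assumes char: "CHAR('k::field) \<noteq> 2"
  shows "\<exists>\<eta>\<^sub>1 \<eta>\<^sub>2 \<eta>\<^sub>3 :: 'k heisenberg \<Rightarrow> 'k heisenberg.
    (heis.involution \<eta>\<^sub>1 \<and> \<eta>\<^sub>1 heis_x = heis_x \<and> \<eta>\<^sub>1 heis_y = - heis_y \<and> \<eta>\<^sub>1 heis_z = heis_z) \<and>
    (heis.involution \<eta>\<^sub>2 \<and> \<eta>\<^sub>2 heis_x = heis_x \<and> \<eta>\<^sub>2 heis_y = heis_y \<and> \<eta>\<^sub>2 heis_z = - heis_z) \<and>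
    (heis.involution \<eta>\<^sub>3 \<and> \<eta>\<^sub>3 heis_x = - heis_x \<and> \<eta>\<^sub>3 heis_y = - heis_y \<and> \<eta>\<^sub>3 heis_z = - heis_z) \<and>
    (\<forall>\<tau>. heis.involution \<tau> \<longrightarrow>
       heis.equivalent \<tau> \<eta>\<^sub>1 \<or> heis.equivalent \<tau> \<eta>\<^sub>2 \<or> heis.equivalent \<tau> \<eta>\<^sub>3) \<and>
    (\<forall>\<tau> a b c d f. heis.involution \<tau> \<and>
       \<tau> heis_x = a *\<^sub>H heis_x + b *\<^sub>H heis_y + c *\<^sub>H heis_z \<and>
       \<tau> heis_y = d *\<^sub>H heis_x - a *\<^sub>H heis_y + f *\<^sub>H heis_z \<and>
       \<tau> heis_z = heis_z \<and>
       a\<^sup>2 + b * d = 1 \<and> (a + 1) * c + b * f = 0 \<and> d * c + (1 - a) * f = 0 \<longrightarrow>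
       heis.equivalent \<tau> \<eta>\<^sub>1) \<and>
    (\<forall>\<tau> c f. heis.involution \<tau> \<and>
       \<tau> heis_x = heis_x + c *\<^sub>H heis_z \<and>
       \<tau> heis_y = heis_y + f *\<^sub>H heis_z \<and>
       \<tau> heis_z = - heis_z \<longrightarrow>
       heis.equivalent \<tau> \<eta>\<^sub>2)"
proof -
  have two: "(2 :: 'k) \<noteq> 0"
  proof
    assume "(2 :: 'k) = 0"
    \<comment> \<open>A divisor of 2 is 1 or 2; a field never has characteristic 1, and
      \<open>char\<close> excludes 2.\<close>
    then have "CHAR('k) dvd 2" using of_nat_eq_0_iff_char_dvd[where 'a = 'k, of 2] by simp
    then have "CHAR('k) \<le> 2" "CHAR('k) \<noteq> 0" by (auto intro: dvd_imp_le intro!: Nat.gr0I)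
    then have "CHAR('k) = 1 \<or> CHAR('k) = 2" by linarith
    then show False using char by simp
  qed
  \<comment> \<open>The third argument is the bracket of the first two in this order, which makes
    the maps reverse brackets; by \<open>xy\<close> its values are \<open>heis_z\<close>,
    \<open>- heis_z\<close> and \<open>- heis_z\<close>.\<close>
  let ?\<eta>\<^sub>1 = "heis_extend heis_x (- heis_y) (heis_bracket heis_x (- heis_y)) :: 'k heisenberg \<Rightarrow> _"
  let ?\<eta>\<^sub>2 = "heis_extend heis_x heis_y (heis_bracket heis_x heis_y) :: 'k heisenberg \<Rightarrow> _"
  let ?\<eta>\<^sub>3 = "heis_extend (- heis_x) (- heis_y) (heis_bracket (- heis_x) (- heis_y)) :: 'k heisenberg \<Rightarrow> _"
  have xy: "heis_bracket heis_x heis_y = - (heis_z :: 'k heisenberg)"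
    unfolding heis_z_def by (rule heis_bracket_swap)
  have inv: "heis.involution ?\<eta>\<^sub>1" "heis.involution ?\<eta>\<^sub>2" "heis.involution ?\<eta>\<^sub>3"
    by (rule involution_heis_extend; simp add: heis_extend_minus)+
  \<comment> \<open>In each of the next three facts \<open>\<tau>\<close> acts on \<open>p\<close>,
    \<open>q\<close> with the same signs as the normal form on \<open>heis_x\<close>,
    \<open>heis_y\<close>, which is what \<open>heis_equivalentI\<close> asks for.\<close>
  have eq1: "heis.equivalent \<tau> ?\<eta>\<^sub>1"
    if "heis.involution \<tau>" "heis_bracket q p \<noteq> 0" "\<tau> p = p" "\<tau> q = - q" for \<tau> p q
    using that by (intro heis_equivalentI[OF _ inv(1), of _ q p]) (simp_all add: heis_extend_minus)
  have eq2: "heis.equivalent \<tau> ?\<eta>\<^sub>2"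
    if "heis.involution \<tau>" "heis_bracket q p \<noteq> 0" "\<tau> p = p" "\<tau> q = q" for \<tau> p q
    using that by (intro heis_equivalentI[OF _ inv(2), of _ q p]) simp_all
  have eq3: "heis.equivalent \<tau> ?\<eta>\<^sub>3"
    if "heis.involution \<tau>" "heis_bracket q p \<noteq> 0" "\<tau> p = - p" "\<tau> q = - q" for \<tau> p q
    using that by (intro heis_equivalentI[OF _ inv(3), of _ q p]) (simp_all add: heis_extend_minus)
  have classify: "heis.equivalent \<tau> ?\<eta>\<^sub>1 \<or> heis.equivalent \<tau> ?\<eta>\<^sub>2 \<or> heis.equivalent \<tau> ?\<eta>\<^sub>3"
    if "heis.involution \<tau>" for \<tau>
    using that by (cases rule: heis_involution_eigenpair[OF two that]) (blast intro: eq1 eq2 eq3)+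
  \<comment> \<open>An involution fixing \<open>heis_z\<close> admits no eigenpair with equal signs,
    which leaves the mixed one.\<close>
  have case1: "heis.equivalent \<tau> ?\<eta>\<^sub>1" if \<tau>: "heis.involution \<tau>" and z: "\<tau> heis_z = heis_z" for \<tau>
    by (cases rule: heis_involution_eigenpair[OF two \<tau>])
      (use \<tau> z heis_involution_z_skew[OF two \<tau>] eq1 in blast)+
  have case2: "heis.equivalent \<tau> ?\<eta>\<^sub>2"
    if \<tau>: "heis.involution \<tau>" and x: "\<tau> heis_x = heis_x + c *\<^sub>H heis_z"
      and y: "\<tau> heis_y = heis_y + f *\<^sub>H heis_z" for \<tau> c f
  proof (rule eq2[OF \<tau>])
    \<comment> \<open>Here a symmetric eigenpair is explicit: the symmetric parts of the generators
      are their doubles up to central terms, so their bracket is 4 times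
      \<open>heis_z\<close>.\<close>
    let ?p = "heis_x + \<tau> heis_x" and ?q = "heis_y + \<tau> heis_y"
    show "\<tau> ?p = ?p" "\<tau> ?q = ?q" by (rule heis.involution_symmetric_part[OF \<tau>])+
    have "?p = 2 *\<^sub>H heis_x + 0 *\<^sub>H heis_y + c *\<^sub>H heis_z"
      "?q = 0 *\<^sub>H heis_x + 2 *\<^sub>H heis_y + f *\<^sub>H heis_z"
      by (simp_all add: x y heis.scale_two add.assoc)
    then have "heis_bracket ?q ?p = (2 * 2) *\<^sub>H heis_z"
      by (simp only: heis_bracket_eq) simp
    then show "heis_bracket ?q ?p \<noteq> 0"
      using two heis_z_nonzero by (metis heis.scale_eq_0_iff mult_eq_0_iff)
  qed
  show ?thesis
    by (rule exI[of _ ?\<eta>\<^sub>1], rule exI[of _ ?\<eta>\<^sub>2], rule exI[of _ ?\<eta>\<^sub>3])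
      (use inv classify case1 case2 in \<open>auto simp: xy\<close>)
qed

end
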